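(* Let $F$ be a finite simple graph with $m=|E(F)|\ge 1$, and let $W$ be a graphon. If for every edge $e\in E(F)$ the edge-rooted density $r_e^W$ is almost everywhere equal to a constant, then either $t(F,W)=0$ or $W=p$ almost everywhere, where $p:=t(F,W)^{1/m}$.
   Context: A graphon is a symmetric measurable function $W\colon[0,1]^2\to[0,1]$. All integrals are with respect to Lebesgue measure. For a finite simple graph $F=(V,E)$, the homomorphism density is $$t(F,W):=\int_{[0,1]^V}\prod_{ij\in E}W(x_i,x_j)\prod_{i\in V}dx_i.$$ For an edge $e=ab\in E$, the edge-rooted density is the function on $[0,1]^2$ $$r_e^W(x,y):=\int_{[0,1]^{V\setminus\{a,b\}}}\prod_{ij\in E}W(z_i,z_j)\prod_{i\in V\setminus\{a,b\}}dz_i,\qquad z_a=x,\ z_b=y$$ (the factor $W(x,y)$ of the edge $e$ itself is included). The constant value of $r_e^W$ is not prescribed. *)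

theory Defs
  imports "HOL-Analysis.Analysis"
begin

definition simple_graph :: "'v set \<Rightarrow> 'v set set \<Rightarrow> bool" where
  "simple_graph V E \<longleftrightarrow> finite V \<and> (\<forall>e\<in>E. e \<subseteq> V \<and> card e = 2)"

abbreviation unit_square :: "(real \<times> real) measure" where
  "unit_square \<equiv> lebesgue_on ({0..1} \<times> {0..1})"

text \<open>Graphons are Lebesgue measurable, not necessarily Borel measurable. Their values
  outside the unit square are irrelevant.\<close>

definition graphon :: "(real \<Rightarrow> real \<Rightarrow> real) \<Rightarrow> bool" where
  "graphon W \<longleftrightarrow>
     (\<lambda>(x, y). W x y) \<in> borel_measurable unit_square \<and>
     (\<forall>x\<in>{0..1}. \<forall>y\<in>{0..1}. W x y = W y x \<and> 0 \<le> W x y \<and> W x y \<le> 1)"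

text \<open>Lebesgue measure on $[0,1]^I$. The completion is essential: for a merely Lebesgue
  measurable \<open>W\<close>, the map \<open>x \<mapsto> W (x i) (x j)\<close> need not be measurable for the product
  sigma-algebra itself, and the Bochner integral of a non-measurable function is \<open>0\<close>.\<close>

definition unit_cube :: "'v set \<Rightarrow> ('v \<Rightarrow> real) measure" where
  "unit_cube I = completion (\<Pi>\<^sub>M i\<in>I. restrict_space lborel {0..1})"

text \<open>The factor \<open>W (x i) (x j)\<close> of an unordered edge \<open>e = {i, j}\<close>; it is well defined since
  \<open>W\<close> is symmetric on the unit square, see \<open>edge_factor_insert\<close>.\<close>

definition edge_factor :: "(real \<Rightarrow> real \<Rightarrow> real) \<Rightarrow> ('v \<Rightarrow> real) \<Rightarrow> 'v set \<Rightarrow> real" where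
  "edge_factor W x e = (THE w. \<exists>i j. e = {i, j} \<and> w = W (x i) (x j))"

lemma edge_factor_insert:
  assumes "graphon W" and "x i \<in> {0..1}" and "x j \<in> {0..1}"
  shows "edge_factor W x {i, j} = W (x i) (x j)"
  unfolding edge_factor_def
proof (rule the_equality)
  show "\<exists>i' j'. {i, j} = {i', j'} \<and> W (x i) (x j) = W (x i') (x j')"
    by blast
next
  fix w assume "\<exists>i' j'. {i, j} = {i', j'} \<and> w = W (x i') (x j')"
  moreover have "W (x j) (x i) = W (x i) (x j)"
    using assms unfolding graphon_def by blast
  ultimately show "w = W (x i) (x j)"
    by (auto simp: doubleton_eq_iff)
qed

definition hom_density :: "'v set \<Rightarrow> 'v set set \<Rightarrow> (real \<Rightarrow> real \<Rightarrow> real) \<Rightarrow> real" where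
  "hom_density V E W = (\<integral>x. (\<Prod>e\<in>E. edge_factor W x e) \<partial>unit_cube V)"

text \<open>The density rooted at the edge \<open>{a, b}\<close>, where \<open>a\<close> is placed at \<open>x\<close> and \<open>b\<close> at \<open>y\<close>.\<close>

definition rooted_density ::
    "'v set \<Rightarrow> 'v set set \<Rightarrow> 'v \<Rightarrow> 'v \<Rightarrow> (real \<Rightarrow> real \<Rightarrow> real) \<Rightarrow> real \<Rightarrow> real \<Rightarrow> real" where
  "rooted_density V E a b W x y =
     (\<integral>z. (\<Prod>e\<in>E. edge_factor W (z(a := x, b := y)) e) \<partial>unit_cube (V - {a, b}))"

end

theory Submission
  imports Defs "HOL-Probability.Infinite_Product_Measure"
begin

text \<open>
  Write \<open>t\<close> for the homomorphism density, assumed positive, \<open>f x\<close> for the product of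
  \<open>W (x i) (x j)\<close> over the \<open>m\<close> edges, and \<open>u = ln W\<close>. Integrating a rooted density over its
  two roots gives \<open>t\<close>, so its constant value is \<open>t\<close>. All factors are at most \<open>1\<close>, hence a
  rooted density is at most \<open>W\<close>; thus \<open>W \<ge> t\<close> almost everywhere and \<open>u\<close> is bounded.

  The probability density \<open>f / t\<close> on the cube has uniform marginals on every edge: this is
  what the hypothesis says. Its logarithm is, up to a constant, a sum over the edges of
  functions that depend on the two coordinates of the edge only, so \<open>f\<close> and the constant \<open>t\<close>
  cannot be told apart by integrating against \<open>ln f\<close>. Therefore
  \<open>\<integral> (f - t) * (ln f - ln t) = 0\<close>, which says that the relative entropies between \<open>f / t\<close> and
  the uniform density, in the two orders, add up to \<open>0\<close>. The integrand is nonnegative and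
  vanishes only where \<open>f = t\<close>, so \<open>f = t\<close> almost everywhere
  (\<open>constant_rooted_densities_imp_constant\<close>).

  It follows that the sum of \<open>u (x i) (x j)\<close> over the edges is almost everywhere constant, and
  this linear condition already makes \<open>u\<close> constant (\<open>constant_edge_sum_imp_constant\<close>).
  Subtract the mean to get \<open>v\<close>, whose edge sum is \<open>0\<close>. The copies of \<open>v\<close> on two distinct edges
  have nonnegative covariance: it is \<open>0\<close> for disjoint edges, and \<open>\<integral> g\<^sup>2\<close> with
  \<open>g y = \<integral> v x y dx\<close> for edges with a common vertex (\<open>edge_covariance_nonneg\<close>). Multiplying
  the vanishing sum by one of its terms and integrating leaves \<open>\<integral> v\<^sup>2 \<le> 0\<close>. So
  \<open>ln W = ln t / m\<close> almost everywhere.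

  Both steps work for a symmetric measurable kernel on any probability space. A graphon is only
  Lebesgue measurable, so it is first replaced by a Borel kernel that agrees with it
  almost everywhere (\<open>graphon_borel_version\<close>); by Fubini this changes each rooted density on
  a null set of roots only.
\<close>

section \<open>Splitting coordinates off a product measure\<close>

lemma measurable_insert_coordinate:
  assumes "a \<in> V"
  shows "(\<lambda>(y, z). z(a := y)) \<in> M \<Otimes>\<^sub>M PiM (V - {a}) (\<lambda>_. M) \<rightarrow>\<^sub>M PiM V (\<lambda>_. M)"
  unfolding split_beta' by (rule measurable_fun_upd[where J="V - {a}"]) (use assms in auto)

lemma measurable_insert_two_coordinates:
  assumes "a \<in> V" "b \<in> V"
  shows "(\<lambda>(p, z). z(a := fst p, b := snd p)) \<in>
    (M \<Otimes>\<^sub>M M) \<Otimes>\<^sub>M PiM (V - {a, b}) (\<lambda>_. M) \<rightarrow>\<^sub>M PiM V (\<lambda>_. M)"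
  unfolding split_beta'
  by (rule measurable_fun_upd[where J="insert a (V - {a, b})"], use assms in blast,
      rule measurable_fun_upd[where J="V - {a, b}"]) auto

context prob_space
begin

lemma prob_space_power: "prob_space (PiM V (\<lambda>_. M))"
  by (intro prob_space_PiM) unfold_locales

lemma distr_insert_coordinate:
  assumes "a \<in> V"
  shows "distr (M \<Otimes>\<^sub>M PiM (V - {a}) (\<lambda>_. M)) (PiM V (\<lambda>_. M)) (\<lambda>(y, z). z(a := y))
    = PiM V (\<lambda>_. M)"
  using distr_pair_PiM_eq_PiM[of "V - {a}" "\<lambda>_. M" a] assms prob_space_axioms
  by (simp add: insert_absorb)

lemma distr_insert_two_coordinates:
  fixes V :: "'v set"
  assumes "finite V" "a \<in> V" "b \<in> V" "a \<noteq> b"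
  shows "distr ((M \<Otimes>\<^sub>M M) \<Otimes>\<^sub>M PiM (V - {a, b}) (\<lambda>_. M)) (PiM V (\<lambda>_. M))
           (\<lambda>(p, z). z(a := fst p, b := snd p)) = PiM V (\<lambda>_. M)"
proof -
  interpret P: product_prob_space "\<lambda>_. M" V by unfold_locales
  let ?J = "V - {a, b}" and ?M = "\<lambda>I. PiM I (\<lambda>_. M)"
  let ?T = "\<lambda>(p, z). z(a := fst p, b := snd p)"
  interpret J: prob_space "?M ?J" by (rule prob_space_power)
  have V: "V = insert a (insert b ?J)" using assms by auto
  note T = measurable_insert_two_coordinates[OF assms(2,3), of M]
  show ?thesis
  proof (rule P.PiM_eqI)
    fix A assume A: "\<And>i. i \<in> V \<Longrightarrow> A i \<in> sets M"
    have sub: "A i \<subseteq> space M" if "i \<in> V" for i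
      using A[OF that] sets.sets_into_space by blast
    have rest: "emeasure (?M ?J) (Pi\<^sub>E ?J A) = (\<Prod>i\<in>?J. emeasure M (A i))"
      using A assms(1)
      by (intro product_sigma_finite.emeasure_PiM[OF P.product_sigma_finite_axioms]) auto
    have "emeasure (distr ((M \<Otimes>\<^sub>M M) \<Otimes>\<^sub>M ?M ?J) (?M V) ?T) (Pi\<^sub>E V A)
        = emeasure ((M \<Otimes>\<^sub>M M) \<Otimes>\<^sub>M ?M ?J) (?T -` Pi\<^sub>E V A \<inter> space ((M \<Otimes>\<^sub>M M) \<Otimes>\<^sub>M ?M ?J))"
      using A assms(1) by (intro emeasure_distr T sets_PiM_I_finite) auto
    also have "?T -` Pi\<^sub>E V A \<inter> space ((M \<Otimes>\<^sub>M M) \<Otimes>\<^sub>M ?M ?J) = (A a \<times> A b) \<times> Pi\<^sub>E ?J A"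
      using assms sub
      by (fastforce simp: space_pair_measure space_PiM PiE_iff extensional_def split: if_splits)
    also have "emeasure ((M \<Otimes>\<^sub>M M) \<Otimes>\<^sub>M ?M ?J) ((A a \<times> A b) \<times> Pi\<^sub>E ?J A)
        = (emeasure M (A a) * emeasure M (A b)) * (\<Prod>i\<in>?J. emeasure M (A i))"
      using A assms
      by (subst J.emeasure_pair_measure_Times)
         (auto simp: emeasure_pair_measure_Times rest intro!: sets_PiM_I_finite)
    also have "\<dots> = (\<Prod>i\<in>V. emeasure M (A i))"
      using assms by (subst (2) V) (auto simp: mult.assoc)
    finally show "emeasure (distr ((M \<Otimes>\<^sub>M M) \<Otimes>\<^sub>M ?M ?J) (?M V) ?T) (Pi\<^sub>E V A)
        = (\<Prod>i\<in>V. emeasure M (A i))" .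
  qed (use assms in auto)
qed

text \<open>
  Integrating over all coordinates except those of the ends of an edge is how rooted densities
  arise, so Fubini is needed with the pair of roots outside and all other vertices inside.
\<close>

lemma AE_insert_two_coordinates:
  fixes V :: "'v set"
  assumes "finite V" "a \<in> V" "b \<in> V" "a \<noteq> b" "AE x in PiM V (\<lambda>_. M). P x"
  shows "AE p in M \<Otimes>\<^sub>M M. AE z in PiM (V - {a, b}) (\<lambda>_. M). P (z(a := fst p, b := snd p))"
proof -
  let ?J = "PiM (V - {a, b}) (\<lambda>_. M)"
  interpret J: prob_space ?J by (rule prob_space_power)
  interpret S: pair_prob_space M M by unfold_locales
  interpret Q: pair_sigma_finite "M \<Otimes>\<^sub>M M" ?J by unfold_locales
  have "AE q in (M \<Otimes>\<^sub>M M) \<Otimes>\<^sub>M ?J. P ((\<lambda>(p, z). z(a := fst p, b := snd p)) q)"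
    by (rule AE_distrD[OF measurable_insert_two_coordinates[OF assms(2,3)]],
        subst distr_insert_two_coordinates[OF assms(1-4)], rule assms(5))
  from Q.AE_pair[OF this] show ?thesis by simp
qed

lemma integral_insert_two_coordinates:
  fixes V :: "'v set" and f :: "('v \<Rightarrow> 'a) \<Rightarrow> real"
  assumes "finite V" "a \<in> V" "b \<in> V" "a \<noteq> b"
    and f: "f \<in> borel_measurable (PiM V (\<lambda>_. M))"
    and B: "\<And>x. x \<in> space (PiM V (\<lambda>_. M)) \<Longrightarrow> \<bar>f x\<bar> \<le> B"
  shows "(\<integral>x. f x \<partial>PiM V (\<lambda>_. M)) =
    (\<integral>p. (\<integral>z. f (z(a := fst p, b := snd p)) \<partial>PiM (V - {a, b}) (\<lambda>_. M)) \<partial>(M \<Otimes>\<^sub>M M))"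
proof -
  let ?J = "PiM (V - {a, b}) (\<lambda>_. M)" and ?P = "PiM V (\<lambda>_. M)"
  let ?T = "\<lambda>(p, z). z(a := fst p, b := snd p)"
  interpret J: prob_space ?J by (rule prob_space_power)
  interpret S: pair_prob_space M M by unfold_locales
  interpret Q: pair_prob_space "M \<Otimes>\<^sub>M M" ?J by unfold_locales
  note T = measurable_insert_two_coordinates[OF assms(2,3), of M]
  have int: "integrable ((M \<Otimes>\<^sub>M M) \<Otimes>\<^sub>M ?J) (\<lambda>q. f (?T q))"
    using measurable_space[OF T]
    by (intro Q.integrable_const_bound[of _ B] AE_I2 measurable_compose[OF T f]) (auto intro!: B)
  have "(\<integral>x. f x \<partial>?P) = (\<integral>q. f (?T q) \<partial>((M \<Otimes>\<^sub>M M) \<Otimes>\<^sub>M ?J))"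
    by (subst distr_insert_two_coordinates[OF assms(1-4), symmetric]) (rule integral_distr[OF T f])
  also have "\<dots> = (\<integral>p. (\<integral>z. f (?T (p, z)) \<partial>?J) \<partial>(M \<Otimes>\<^sub>M M))"
    by (rule Q.integral_fst'[OF int, symmetric])
  finally show ?thesis by simp
qed

text \<open>
  Averaging over one coordinate while keeping the others is a conditional expectation, hence
  preserves the integral. Keeping the full product measure on both sides, with the averaged
  coordinate still present as a dummy, allows the step to be iterated without changing spaces.
\<close>

lemma integral_resample_coordinate:
  fixes f :: "('v \<Rightarrow> 'a) \<Rightarrow> real"
  assumes "a \<in> V" and f: "f \<in> borel_measurable (PiM V (\<lambda>_. M))"
    and B: "\<And>x. x \<in> space (PiM V (\<lambda>_. M)) \<Longrightarrow> \<bar>f x\<bar> \<le> B"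
  shows "(\<integral>x. f x \<partial>PiM V (\<lambda>_. M)) = (\<integral>x. (\<integral>y. f (x(a := y)) \<partial>M) \<partial>PiM V (\<lambda>_. M))"
proof -
  let ?P = "PiM V (\<lambda>_. M)" and ?J = "PiM (V - {a}) (\<lambda>_. M)"
  let ?T = "\<lambda>(y, z). z(a := y)"
  interpret J: prob_space ?J by (rule prob_space_power)
  interpret Q: pair_prob_space M ?J by unfold_locales
  note T = measurable_insert_coordinate[OF assms(1), of M]
  have split: "(\<integral>x. g x \<partial>?P) = (\<integral>z. (\<integral>y. g (z(a := y)) \<partial>M) \<partial>?J)"
    if g: "g \<in> borel_measurable ?P" and b: "\<And>x. x \<in> space ?P \<Longrightarrow> \<bar>g x\<bar> \<le> B"
    for g :: "('v \<Rightarrow> 'a) \<Rightarrow> real"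
  proof -
    have int: "integrable (M \<Otimes>\<^sub>M ?J) (\<lambda>(y, z). g (z(a := y)))"
      using measurable_space[OF T] measurable_compose[OF T g]
      by (intro Q.integrable_const_bound[of _ B] AE_I2) (auto intro!: b simp: split_beta')
    have "(\<integral>x. g x \<partial>?P) = (\<integral>q. g (?T q) \<partial>(M \<Otimes>\<^sub>M ?J))"
      by (subst distr_insert_coordinate[OF assms(1), symmetric]) (rule integral_distr[OF T g])
    also have "\<dots> = (\<integral>z. (\<integral>y. g (z(a := y)) \<partial>M) \<partial>?J)"
      using Q.integral_snd[OF int] by (simp add: split_beta')
    finally show ?thesis .
  qed
  have upd: "(\<lambda>(x, y). x(a := y)) \<in> ?P \<Otimes>\<^sub>M M \<rightarrow>\<^sub>M ?P"
    unfolding split_beta' by (rule measurable_fun_upd[where J=V]) (use assms in auto)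
  have meas: "(\<lambda>(x, y). f (x(a := y))) \<in> borel_measurable (?P \<Otimes>\<^sub>M M)"
    using measurable_compose[OF upd f] by (simp add: split_beta')
  have avg: "(\<lambda>x. \<integral>y. f (x(a := y)) \<partial>M) \<in> borel_measurable ?P"
    using meas by (rule borel_measurable_lebesgue_integral)
  have bound: "\<bar>\<integral>y. f (x(a := y)) \<partial>M\<bar> \<le> B" if x: "x \<in> space ?P" for x
  proof -
    have *: "\<bar>f (x(a := y))\<bar> \<le> B" if "y \<in> space M" for y
      using measurable_space[OF upd, of "(x, y)"] x that by (auto simp: space_pair_measure intro: B)
    have "integrable M (\<lambda>y. f (x(a := y)))"
      using measurable_Pair2[OF meas x] by (intro integrable_const_bound[of _ B] AE_I2) (auto intro: *)
    then have "(\<integral>y. f (x(a := y)) \<partial>M) \<le> B" "- B \<le> (\<integral>y. f (x(a := y)) \<partial>M)"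
      using * by (auto intro!: integral_le_const integral_ge_const AE_I2 simp: abs_le_iff)
        (metis minus_le_iff)
    then show ?thesis by auto
  qed
  have "(\<integral>x. (\<integral>y. f (x(a := y)) \<partial>M) \<partial>?P) = (\<integral>z. (\<integral>x. (\<integral>y. f (z(a := x, a := y)) \<partial>M) \<partial>M) \<partial>?J)"
    by (rule split[OF avg bound])
  also have "\<dots> = (\<integral>z. (\<integral>y. f (z(a := y)) \<partial>M) \<partial>?J)"
    by (simp add: prob_space)
  also have "\<dots> = (\<integral>x. f x \<partial>?P)"
    by (rule split[OF f B, symmetric])
  finally show ?thesis ..
qed

section \<open>Kernels with a constant edge sum\<close>

text \<open>
  Two distinct edges \<open>{a, b}\<close> and \<open>{c, d}\<close> can be labelled such that \<open>a\<close> and \<open>c\<close> each lie on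
  one of them only. Averaging over \<open>a\<close> and \<open>c\<close> turns the integrand into \<open>g (x b) * g (x d)\<close>
  with \<open>g\<close> the one-variable marginal of \<open>v\<close>: a square if \<open>b = d\<close>, and otherwise a
  product of two independent variables of mean \<open>0\<close>.
\<close>

lemma edge_covariance_nonneg:
  fixes v :: "'a \<Rightarrow> 'a \<Rightarrow> real" and V :: "'v set"
  assumes meas[measurable]: "(\<lambda>(x, y). v x y) \<in> borel_measurable (M \<Otimes>\<^sub>M M)"
    and B: "\<And>x y. x \<in> space M \<Longrightarrow> y \<in> space M \<Longrightarrow> \<bar>v x y\<bar> \<le> B"
    and mean: "(\<integral>p. v (fst p) (snd p) \<partial>(M \<Otimes>\<^sub>M M)) = 0"
    and V: "a \<in> V" "b \<in> V" "c \<in> V" "d \<in> V"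
    and ne: "a \<noteq> b" "a \<noteq> c" "a \<noteq> d" "c \<noteq> b" "c \<noteq> d"
  shows "0 \<le> (\<integral>x. v (x a) (x b) * v (x c) (x d) \<partial>PiM V (\<lambda>_. M))"
proof -
  let ?P = "PiM V (\<lambda>_. M)"
  interpret S: pair_prob_space M M by unfold_locales
  define g where "g y = (\<integral>x. v x y \<partial>M)" for y
  have coord[measurable]: "(\<lambda>x. x i) \<in> ?P \<rightarrow>\<^sub>M M" if "i \<in> V" for i
    using that by measurable
  have mem: "x i \<in> space M" if "x \<in> space ?P" "i \<in> V" for x i
    using measurable_space[OF coord] that by blast
  have int: "integrable (M \<Otimes>\<^sub>M M) (\<lambda>(x, y). v x y)"
    using meas by (intro S.integrable_const_bound[of _ B] AE_I2) (auto simp: space_pair_measure B)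
  have g[measurable]: "g \<in> borel_measurable M"
    unfolding g_def by measurable
  have g_bound: "\<bar>g y\<bar> \<le> B" if y: "y \<in> space M" for y
  proof -
    have "integrable M (\<lambda>x. v x y)"
      using y by (intro integrable_const_bound[of _ B] AE_I2) (auto intro: B)
    then have "g y \<le> B" "- B \<le> g y"
      unfolding g_def using B[OF _ y]
      by (auto intro!: integral_le_const integral_ge_const AE_I2 simp: abs_le_iff)
        (metis minus_le_iff)
    then show ?thesis by auto
  qed
  have g_mean: "(\<integral>y. g y \<partial>M) = 0"
    using S.integral_snd[OF int] mean by (simp add: g_def split_beta')
  have vm[measurable]: "(\<lambda>x. v (x i) (x j)) \<in> borel_measurable ?P" if "i \<in> V" "j \<in> V" for i j
    using measurable_compose[OF measurable_Pair[OF coord coord] meas] that by simp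
  have gm[measurable]: "(\<lambda>x. g (x i)) \<in> borel_measurable ?P" if "i \<in> V" for i
    using measurable_compose[OF coord g] that by simp
  have "(\<integral>x. v (x a) (x b) * v (x c) (x d) \<partial>?P) = (\<integral>x. g (x b) * v (x c) (x d) \<partial>?P)"
    using V ne
    by (subst integral_resample_coordinate[where a=a and B="B * B"])
       (auto simp: abs_mult simp flip: g_def intro!: mult_mono' B mem)
  also have "\<dots> = (\<integral>x. g (x b) * g (x d) \<partial>?P)"
    using V ne
    by (subst integral_resample_coordinate[where a=c and B="B * B"])
       (auto simp: abs_mult simp flip: g_def intro!: mult_mono' B g_bound mem)
  also have "\<dots> \<ge> 0"
  proof (cases "b = d")
    case False
    have "(\<integral>x. g (x b) * g (x d) \<partial>?P) = 0"
      using V ne False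
      by (subst integral_resample_coordinate[where a=b and B="B * B"])
         (auto simp: g_mean abs_mult intro!: mult_mono' g_bound mem)
    then show ?thesis by simp
  qed simp
  finally show ?thesis .
qed

lemma distr_two_coordinates:
  fixes V :: "'v set"
  assumes "finite V" "a \<in> V" "b \<in> V" "a \<noteq> b"
  shows "distr (PiM V (\<lambda>_. M)) (M \<Otimes>\<^sub>M M) (\<lambda>x. (x a, x b)) = M \<Otimes>\<^sub>M M"
proof -
  let ?J = "PiM (V - {a, b}) (\<lambda>_. M)" and ?P = "PiM V (\<lambda>_. M)"
  let ?T = "\<lambda>(p, z). z(a := fst p, b := snd p)"
  interpret J: prob_space ?J by (rule prob_space_power)
  have pr: "(\<lambda>x. (x a, x b)) \<in> ?P \<rightarrow>\<^sub>M M \<Otimes>\<^sub>M M"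
    using assms by (intro measurable_Pair measurable_component_singleton)
  have "distr ?P (M \<Otimes>\<^sub>M M) (\<lambda>x. (x a, x b))
      = distr (distr ((M \<Otimes>\<^sub>M M) \<Otimes>\<^sub>M ?J) ?P ?T) (M \<Otimes>\<^sub>M M) (\<lambda>x. (x a, x b))"
    by (subst distr_insert_two_coordinates[OF assms]) (rule refl)
  also have "\<dots> = distr ((M \<Otimes>\<^sub>M M) \<Otimes>\<^sub>M ?J) (M \<Otimes>\<^sub>M M) ((\<lambda>x. (x a, x b)) \<circ> ?T)"
    by (rule distr_distr[OF pr measurable_insert_two_coordinates[OF assms(2,3)]])
  also have "(\<lambda>x. (x a, x b)) \<circ> ?T = fst"
    using assms(4) by (auto simp: fun_eq_iff)
  finally show ?thesis
    by (simp add: J.distr_pair_fst)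
qed

lemma AE_two_coordinates:
  fixes V :: "'v set"
  assumes "finite V" "a \<in> V" "b \<in> V" "a \<noteq> b" "AE p in M \<Otimes>\<^sub>M M. P p"
  shows "AE x in PiM V (\<lambda>_. M). P (x a, x b)"
proof (rule AE_distrD[where f="\<lambda>x. (x a, x b)" and M'="M \<Otimes>\<^sub>M M" and P=P])
  show "(\<lambda>x. (x a, x b)) \<in> PiM V (\<lambda>_. M) \<rightarrow>\<^sub>M M \<Otimes>\<^sub>M M"
    using assms by (intro measurable_Pair measurable_component_singleton)
  show "AE p in distr (PiM V (\<lambda>_. M)) (M \<Otimes>\<^sub>M M) (\<lambda>x. (x a, x b)). P p"
    by (subst distr_two_coordinates[OF assms(1-4)]) (rule assms(5))
qed

lemma integral_two_coordinates:
  fixes V :: "'v set" and h :: "'a \<times> 'a \<Rightarrow> real"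
  assumes "finite V" "a \<in> V" "b \<in> V" "a \<noteq> b" and h: "h \<in> borel_measurable (M \<Otimes>\<^sub>M M)"
  shows "(\<integral>x. h (x a, x b) \<partial>PiM V (\<lambda>_. M)) = (\<integral>p. h p \<partial>(M \<Otimes>\<^sub>M M))"
proof -
  have "(\<lambda>x. (x a, x b)) \<in> PiM V (\<lambda>_. M) \<rightarrow>\<^sub>M M \<Otimes>\<^sub>M M"
    using assms by (intro measurable_Pair measurable_component_singleton)
  from integral_distr[OF this h] show ?thesis
    by (simp only: distr_two_coordinates[OF assms(1-4)])
qed

text \<open>
  Let \<open>v = u - k\<close> with \<open>k\<close> the mean of \<open>u\<close>. The sum of the copies of \<open>v\<close> over the edges has mean
  \<open>0\<close> and is constant, so it vanishes. Its product with the copy on a fixed edge \<open>e0\<close> has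
  integral \<open>0\<close> and is made of \<open>\<integral> v\<^sup>2\<close> and nonnegative covariances, so \<open>v = 0\<close>.
  The functions \<open>i\<close> and \<open>j\<close> choose an orientation of each edge, which is harmless as \<open>u\<close> is
  symmetric.
\<close>

lemma constant_edge_sum_imp_constant:
  fixes u :: "'a \<Rightarrow> 'a \<Rightarrow> real" and V :: "'v set" and E :: "'v set set" and i j :: "'v set \<Rightarrow> 'v"
  assumes fin: "finite V" "finite E" "E \<noteq> {}"
    and ends: "\<And>e. e \<in> E \<Longrightarrow> i e \<in> V \<and> j e \<in> V \<and> i e \<noteq> j e \<and> e = {i e, j e}"
    and meas: "(\<lambda>(x, y). u x y) \<in> borel_measurable (M \<Otimes>\<^sub>M M)"
    and B: "\<And>x y. x \<in> space M \<Longrightarrow> y \<in> space M \<Longrightarrow> \<bar>u x y\<bar> \<le> B"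
    and sym: "\<And>x y. x \<in> space M \<Longrightarrow> y \<in> space M \<Longrightarrow> u x y = u y x"
    and sum: "AE x in PiM V (\<lambda>_. M). (\<Sum>e\<in>E. u (x (i e)) (x (j e))) = c"
  shows "AE p in M \<Otimes>\<^sub>M M. u (fst p) (snd p) = c / card E"
proof -
  let ?P = "PiM V (\<lambda>_. M)"
  interpret S: pair_prob_space M M by unfold_locales
  interpret P: prob_space ?P by (rule prob_space_power)
  define k where "k = (\<integral>p. u (fst p) (snd p) \<partial>(M \<Otimes>\<^sub>M M))"
  define v where "v x y = u x y - k" for x y
  have meas_u[measurable]: "(\<lambda>p. u (fst p) (snd p)) \<in> borel_measurable (M \<Otimes>\<^sub>M M)"
    using meas by (simp add: split_beta')
  have meas_v[measurable]: "(\<lambda>p. v (fst p) (snd p)) \<in> borel_measurable (M \<Otimes>\<^sub>M M)"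
    unfolding v_def by measurable
  define C where "C = B + \<bar>k\<bar>"
  have C: "\<bar>v x y\<bar> \<le> C" if "x \<in> space M" "y \<in> space M" for x y
    using B[OF that] unfolding v_def C_def by linarith
  have mean: "(\<integral>p. v (fst p) (snd p) \<partial>(M \<Otimes>\<^sub>M M)) = 0"
  proof -
    have "integrable (M \<Otimes>\<^sub>M M) (\<lambda>p. u (fst p) (snd p))"
      by (intro S.integrable_const_bound[of _ B] AE_I2) (auto simp: space_pair_measure B)
    then show ?thesis
      unfolding v_def by (simp add: k_def S.prob_space)
  qed
  have coord: "(\<lambda>x. x l) \<in> ?P \<rightarrow>\<^sub>M M" if "l \<in> V" for l
    using that by (rule measurable_component_singleton)
  have mem: "x l \<in> space M" if "x \<in> space ?P" "l \<in> V" for x l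
    using measurable_space[OF coord] that by blast
  have vm[measurable]: "(\<lambda>x. v (x (i e)) (x (j e))) \<in> borel_measurable ?P" if "e \<in> E" for e
    using measurable_compose[OF measurable_Pair[OF coord coord] meas_v] ends[OF that] by simp
  have vb: "\<bar>v (x (i e)) (x (j e))\<bar> \<le> C" if "e \<in> E" "x \<in> space ?P" for e x
    using ends[OF that(1)] that(2) by (intro C mem) auto
  have int: "integrable ?P (\<lambda>x. v (x (i e)) (x (j e)))" if "e \<in> E" for e
    using that by (intro P.integrable_const_bound[of _ C] AE_I2) (auto intro: vb)
  have int2: "integrable ?P (\<lambda>x. v (x (i e)) (x (j e)) * v (x (i e')) (x (j e')))"
    if "e \<in> E" "e' \<in> E" for e e'
    using that by (intro P.integrable_const_bound[of _ "C * C"] AE_I2)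
      (auto simp: abs_mult intro!: mult_mono' vb)
  have edge_mean: "(\<integral>x. v (x (i e)) (x (j e)) \<partial>?P) = 0" if "e \<in> E" for e
    using integral_two_coordinates[of V "i e" "j e", OF _ _ _ _ meas_v] ends[OF that] fin mean
    by simp
  have sum_v: "AE x in ?P. (\<Sum>e\<in>E. v (x (i e)) (x (j e))) = c - card E * k"
    using sum by eventually_elim (simp add: v_def sum_subtractf)
  have "c - card E * k = (\<integral>x. (\<Sum>e\<in>E. v (x (i e)) (x (j e))) \<partial>?P)"
    using integral_cong_AE[OF _ _ sum_v] by (simp add: P.prob_space)
  also have "\<dots> = 0"
    using int edge_mean by (subst Bochner_Integration.integral_sum) auto
  finally have ck: "c = card E * k" by simp
  obtain e0 where e0: "e0 \<in> E" using fin by auto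
  have cov: "0 \<le> (\<integral>x. v (x (i e0)) (x (j e0)) * v (x (i e)) (x (j e)) \<partial>?P)"
    if e: "e \<in> E" "e \<noteq> e0" for e
  proof -
    \<comment> \<open>Each edge may be read starting from either of its ends, by symmetry.\<close>
    have orient: "\<exists>b. b \<in> V \<and> a \<noteq> b \<and> e = {a, b} \<and>
        (\<forall>x\<in>space ?P. v (x (i e)) (x (j e)) = v (x a) (x b))" if "e \<in> E" "a \<in> e" for e a
    proof (cases "a = i e")
      case True
      then show ?thesis using ends[OF that(1)] by (intro exI[of _ "j e"]) auto
    next
      case False
      then have "a = j e" using ends[OF that(1)] that by auto
      then show ?thesis using ends[OF that(1)] sym mem
        by (intro exI[of _ "i e"]) (auto simp: v_def)
    qed
    have "finite e" "card e = 2" if "e \<in> E" for e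
      using ends[OF that] by (metis finite.emptyI finite.insertI, metis card_2_iff)
    then have "\<not> e0 \<subseteq> e" "\<not> e \<subseteq> e0"
      using e e0 by (metis card_subset_eq)+
    then obtain a d where a: "a \<in> e0" "a \<notin> e" and d: "d \<in> e" "d \<notin> e0" by blast
    obtain b where b: "b \<in> V" "a \<noteq> b" "e0 = {a, b}"
      "\<And>x. x \<in> space ?P \<Longrightarrow> v (x (i e0)) (x (j e0)) = v (x a) (x b)"
      using orient[OF e0 a(1)] by blast
    obtain d' where d': "d' \<in> V" "d \<noteq> d'" "e = {d, d'}"
      "\<And>x. x \<in> space ?P \<Longrightarrow> v (x (i e)) (x (j e)) = v (x d) (x d')"
      using orient[OF e(1) d(1)] by blast
    have "a \<in> V" "d \<in> V"
      using a(1) d(1) ends[OF e0] ends[OF e(1)] by (metis insertE singletonD)+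
    then have "0 \<le> (\<integral>x. v (x a) (x b) * v (x d) (x d') \<partial>?P)"
      using a d b d' meas_v
      by (intro edge_covariance_nonneg[OF _ C mean]) (auto simp: split_beta')
    also have "\<dots> = (\<integral>x. v (x (i e0)) (x (j e0)) * v (x (i e)) (x (j e)) \<partial>?P)"
      by (rule Bochner_Integration.integral_cong) (simp_all add: b(4) d'(4))
    finally show ?thesis .
  qed
  have "(\<integral>x. v (x (i e0)) (x (j e0)) * v (x (i e0)) (x (j e0)) \<partial>?P)
      \<le> (\<Sum>e\<in>E. \<integral>x. v (x (i e0)) (x (j e0)) * v (x (i e)) (x (j e)) \<partial>?P)"
    using fin(2) e0 cov by (subst sum.remove[of _ e0]) (auto intro!: sum_nonneg)
  also have "\<dots> = (\<integral>x. v (x (i e0)) (x (j e0)) * (\<Sum>e\<in>E. v (x (i e)) (x (j e))) \<partial>?P)"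
    using int2[OF e0] by (simp add: sum_distrib_left Bochner_Integration.integral_sum)
  also have "\<dots> = (\<integral>x. 0 \<partial>?P)"
    using sum_v ck e0 by (intro integral_cong_AE) auto
  also have "(\<integral>x. v (x (i e0)) (x (j e0)) * v (x (i e0)) (x (j e0)) \<partial>?P)
      = (\<integral>p. v (fst p) (snd p) * v (fst p) (snd p) \<partial>(M \<Otimes>\<^sub>M M))"
    using integral_two_coordinates[of V "i e0" "j e0" "\<lambda>p. v (fst p) (snd p) * v (fst p) (snd p)"]
      ends[OF e0] fin by simp
  finally have "(\<integral>p. v (fst p) (snd p) * v (fst p) (snd p) \<partial>(M \<Otimes>\<^sub>M M)) = 0"
    by (intro antisym integral_nonneg_AE) auto
  moreover have "integrable (M \<Otimes>\<^sub>M M) (\<lambda>p. v (fst p) (snd p) * v (fst p) (snd p))"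
  proof (intro S.integrable_const_bound[of _ "C * C"] AE_I2)
    fix p assume "p \<in> space (M \<Otimes>\<^sub>M M)"
    then have "\<bar>v (fst p) (snd p)\<bar> \<le> C"
      by (auto simp: space_pair_measure C)
    then show "norm (v (fst p) (snd p) * v (fst p) (snd p)) \<le> C * C"
      unfolding real_norm_def abs_mult by (intro mult_mono') auto
  qed measurable
  ultimately have "AE p in M \<Otimes>\<^sub>M M. v (fst p) (snd p) * v (fst p) (snd p) = 0"
    by (subst (asm) integral_nonneg_eq_0_iff_AE) auto
  then show ?thesis
    using ck fin by (simp add: v_def)
qed

section \<open>Kernels with constant rooted densities\<close>

text \<open>
  The function \<open>D = (F - t) * (ln F - ln t)\<close> is nonnegative and vanishes only where \<open>F = t\<close>.
  Its integral is \<open>0\<close> because \<open>ln F\<close> is a sum of functions of single edges, and the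
  weight \<open>F\<close> acts on such a function like the constant \<open>t\<close> (the fact \<open>weighted\<close> below).
\<close>

lemma constant_rooted_densities_imp_constant:
  fixes w :: "'a \<Rightarrow> 'a \<Rightarrow> real" and V :: "'v set" and E :: "'v set set" and i j :: "'v set \<Rightarrow> 'v"
  defines "F \<equiv> \<lambda>x. \<Prod>e\<in>E. w (x (i e)) (x (j e))"
  assumes fin: "finite V" "finite E" "E \<noteq> {}"
    and ends: "\<And>e. e \<in> E \<Longrightarrow> i e \<in> V \<and> j e \<in> V \<and> i e \<noteq> j e \<and> e = {i e, j e}"
    and meas: "(\<lambda>(x, y). w x y) \<in> borel_measurable (M \<Otimes>\<^sub>M M)"
    and w: "\<And>x y. x \<in> space M \<Longrightarrow> y \<in> space M \<Longrightarrow> 0 \<le> w x y \<and> w x y \<le> 1"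
    and sym: "\<And>x y. x \<in> space M \<Longrightarrow> y \<in> space M \<Longrightarrow> w x y = w y x"
    and t: "0 < t"
    and rooted: "\<And>e. e \<in> E \<Longrightarrow> AE p in M \<Otimes>\<^sub>M M.
       (\<integral>z. F (z(i e := fst p, j e := snd p)) \<partial>PiM (V - {i e, j e}) (\<lambda>_. M)) = t"
  shows "AE p in M \<Otimes>\<^sub>M M. w (fst p) (snd p) = t powr (1 / card E)"
proof -
  let ?P = "PiM V (\<lambda>_. M)" and ?J = "\<lambda>e. PiM (V - {i e, j e}) (\<lambda>_. M)"
  interpret S: pair_prob_space M M by unfold_locales
  interpret P: prob_space ?P by (rule prob_space_power)
  have meas_w[measurable]: "(\<lambda>p. w (fst p) (snd p)) \<in> borel_measurable (M \<Otimes>\<^sub>M M)"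
    using meas by (simp add: split_beta')
  have coord: "(\<lambda>x. x l) \<in> ?P \<rightarrow>\<^sub>M M" if "l \<in> V" for l
    using that by (rule measurable_component_singleton)
  have mem: "x l \<in> space M" if "x \<in> space ?P" "l \<in> V" for x l
    using measurable_space[OF coord] that by blast
  have edge_meas: "(\<lambda>x. h (x (i e), x (j e))) \<in> borel_measurable ?P"
    if "e \<in> E" "h \<in> borel_measurable (M \<Otimes>\<^sub>M M)" for e and h :: "'a \<times> 'a \<Rightarrow> real"
    using ends[OF that(1)] by (intro measurable_compose[OF measurable_Pair[OF coord coord] that(2)]) auto
  have edge_w: "0 \<le> w (x (i e)) (x (j e)) \<and> w (x (i e)) (x (j e)) \<le> 1"
    if "e \<in> E" "x \<in> space ?P" for e x
    using ends[OF that(1)] that(2) by (intro w mem) auto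
  have F_meas[measurable]: "F \<in> borel_measurable ?P"
    unfolding F_def using edge_meas[OF _ meas_w] by (intro borel_measurable_prod) simp
  have F0: "0 \<le> F x" if "x \<in> space ?P" for x
    unfolding F_def using edge_w[OF _ that] by (intro prod_nonneg) auto
  have F_le: "F x \<le> w (x (i e)) (x (j e))" if e: "e \<in> E" and x: "x \<in> space ?P" for e x
  proof -
    have "(\<Prod>e\<in>E - {e}. w (x (i e)) (x (j e))) \<le> 1"
      using edge_w[OF _ x] by (intro prod_le_1) auto
    then show ?thesis
      unfolding F_def using edge_w[OF e x] fin(2) e by (subst prod.remove[of _ e]) (auto intro: mult_left_le)
  qed
  have F1: "F x \<le> 1" if "x \<in> space ?P" for x
    using F_le[OF _ that] edge_w[OF _ that] fin(3) by (meson all_not_in_conv order_trans)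
  have F_abs: "\<bar>F x\<bar> \<le> 1" if "x \<in> space ?P" for x
    using F0[OF that] F1[OF that] by simp
  have section_meas: "(\<lambda>(p, z). F (z(i e := fst p, j e := snd p)))
      \<in> borel_measurable ((M \<Otimes>\<^sub>M M) \<Otimes>\<^sub>M ?J e)" if "e \<in> E" for e
    using measurable_compose[OF measurable_insert_two_coordinates F_meas, of "i e" "j e"] ends[OF that]
    by (simp add: split_beta')
  have w_ge: "AE p in M \<Otimes>\<^sub>M M. t \<le> w (fst p) (snd p)"
  proof -
    obtain e where e: "e \<in> E" using fin(3) by auto
    interpret J: prob_space "?J e" by (rule prob_space_power)
    have T: "z(i e := fst p, j e := snd p) \<in> space ?P"
      if "p \<in> space (M \<Otimes>\<^sub>M M)" "z \<in> space (?J e)" for p z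
      using measurable_space[OF measurable_insert_two_coordinates[of "i e" V "j e" M], of "(p, z)"]
        ends[OF e] that by (simp add: space_pair_measure)
    have "(\<integral>z. F (z(i e := fst p, j e := snd p)) \<partial>?J e) \<le> w (fst p) (snd p)"
      if p: "p \<in> space (M \<Otimes>\<^sub>M M)" for p
    proof (rule J.integral_le_const)
      show "integrable (?J e) (\<lambda>z. F (z(i e := fst p, j e := snd p)))"
        using measurable_Pair2[OF section_meas[OF e] p] T[OF p]
        by (intro J.integrable_const_bound[of _ 1] AE_I2) (auto intro: F_abs)
      show "AE z in ?J e. F (z(i e := fst p, j e := snd p)) \<le> w (fst p) (snd p)"
        using F_le[OF e T[OF p]] ends[OF e] by (intro AE_I2) simp
    qed
    with rooted[OF e] show ?thesis by (auto elim: AE_mp)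
  qed
  \<comment> \<open>By \<open>w_ge\<close> the truncation at \<open>t\<close> is almost nowhere active; it makes \<open>u\<close> bounded everywhere.\<close>
  define u where "u x y = ln (max t (w x y))" for x y
  have meas_u[measurable]: "(\<lambda>p. u (fst p) (snd p)) \<in> borel_measurable (M \<Otimes>\<^sub>M M)"
    unfolding u_def by measurable
  have u_bound: "\<bar>u x y\<bar> \<le> \<bar>ln t\<bar>" if "x \<in> space M" "y \<in> space M" for x y
    using w[OF that] t unfolding u_def by (auto simp: max_def)
  let ?u = "\<lambda>e x. u (x (i e)) (x (j e))"
  have ue_meas[measurable]: "?u e \<in> borel_measurable ?P" if "e \<in> E" for e
    using edge_meas[OF that meas_u] by simp
  have ue_bound: "\<bar>?u e x\<bar> \<le> \<bar>ln t\<bar>" if "e \<in> E" "x \<in> space ?P" for e x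
    using ends[OF that(1)] that(2) by (intro u_bound mem) auto
  have int_u: "integrable ?P (?u e)" if "e \<in> E" for e
    using that by (intro P.integrable_const_bound[of _ "\<bar>ln t\<bar>"] AE_I2) (auto intro: ue_bound)
  have int_F: "integrable ?P F"
    by (intro P.integrable_const_bound[of _ 1] AE_I2) (auto intro: F_abs)
  have int_Fu: "integrable ?P (\<lambda>x. F x * ?u e x)" if "e \<in> E" for e
    using that by (intro P.integrable_const_bound[of _ "1 * \<bar>ln t\<bar>"] AE_I2)
      (auto simp only: abs_mult real_norm_def intro!: mult_mono ue_bound F_abs ue_meas F_meas borel_measurable_times)
  have weighted: "(\<integral>x. F x * h (x (i e), x (j e)) \<partial>?P) = t * (\<integral>x. h (x (i e), x (j e)) \<partial>?P)"
    if e: "e \<in> E" and h[measurable]: "h \<in> borel_measurable (M \<Otimes>\<^sub>M M)"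
      and h_bound: "\<And>p. p \<in> space (M \<Otimes>\<^sub>M M) \<Longrightarrow> \<bar>h p\<bar> \<le> B" for e B and h :: "'a \<times> 'a \<Rightarrow> real"
  proof -
    interpret J: prob_space "?J e" by (rule prob_space_power)
    note section_meas[OF e, measurable]
    note he = edge_meas[OF e h]
    have hb: "\<bar>h (x (i e), x (j e))\<bar> \<le> B" if "x \<in> space ?P" for x
      using ends[OF e] that by (intro h_bound) (auto simp: space_pair_measure mem)
    have root_meas: "(\<lambda>p. \<integral>z. F (z(i e := fst p, j e := snd p)) \<partial>?J e) \<in> borel_measurable (M \<Otimes>\<^sub>M M)"
      using section_meas[OF e] by (rule J.borel_measurable_lebesgue_integral)
    have ij: "i e \<in> V" "j e \<in> V" "i e \<noteq> j e"
      using ends[OF e] by blast+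
    have "\<bar>F x * h (x (i e), x (j e))\<bar> \<le> 1 * B" if "x \<in> space ?P" for x
      unfolding abs_mult using that by (intro mult_mono F_abs hb) auto
    then have "(\<integral>x. F x * h (x (i e), x (j e)) \<partial>?P) = (\<integral>p. (\<integral>z. F (z(i e := fst p, j e := snd p))
        * h ((z(i e := fst p, j e := snd p)) (i e), (z(i e := fst p, j e := snd p)) (j e)) \<partial>?J e) \<partial>(M \<Otimes>\<^sub>M M))"
      using he by (intro integral_insert_two_coordinates[OF fin(1) ij]) auto
    also have "\<dots> = (\<integral>p. (\<integral>z. F (z(i e := fst p, j e := snd p)) \<partial>?J e) * h p \<partial>(M \<Otimes>\<^sub>M M))"
      using ij(3) by simp
    also have "\<dots> = (\<integral>p. t * h p \<partial>(M \<Otimes>\<^sub>M M))"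
      using rooted[OF e] root_meas by (intro integral_cong_AE) auto
    also have "\<dots> = t * (\<integral>x. h (x (i e), x (j e)) \<partial>?P)"
      using integral_two_coordinates[of V "i e" "j e" h] ends[OF e] fin(1) by simp
    finally show ?thesis .
  qed
  have F_mean: "(\<integral>x. F x \<partial>?P) = t"
    using weighted[of _ "\<lambda>_. 1" 1] fin(3) by (auto simp: P.prob_space)
  define D where "D x = (F x - t) * ((\<Sum>e\<in>E. ?u e x) - ln t)" for x
  have D_expand: "D x = (\<Sum>e\<in>E. F x * ?u e x - t * ?u e x) - ln t * (F x - t)" for x
    unfolding D_def by (simp add: sum_subtractf algebra_simps sum_distrib_left)
  have int_D: "integrable ?P D"
    unfolding D_expand using int_u int_Fu int_F by auto
  have D_mean: "(\<integral>x. D x \<partial>?P) = 0"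
  proof -
    have "(\<integral>x. D x \<partial>?P) = (\<Sum>e\<in>E. (\<integral>x. F x * ?u e x \<partial>?P) - t * (\<integral>x. ?u e x \<partial>?P)) - ln t * ((\<integral>x. F x \<partial>?P) - t)"
      unfolding D_expand using int_u int_Fu int_F by (simp add: P.prob_space)
    also have "\<dots> = 0"
    proof -
      have "\<bar>u (fst p) (snd p)\<bar> \<le> \<bar>ln t\<bar>" if "p \<in> space (M \<Otimes>\<^sub>M M)" for p
        using that by (intro u_bound) (auto simp: space_pair_measure)
      note weighted[OF _ meas_u this]
      with F_mean show ?thesis by simp
    qed
    finally show ?thesis .
  qed
  have edges_ge: "AE x in ?P. \<forall>e\<in>E. t \<le> w (x (i e)) (x (j e))"
    using AE_two_coordinates[of V "i _" "j _", OF fin(1) _ _ _ w_ge] ends fin(2)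
    by (intro AE_finite_allI) auto
  have log_F: "AE x in ?P. 0 < F x \<and> (\<Sum>e\<in>E. ?u e x) = ln (F x)"
    using edges_ge
  proof eventually_elim
    case (elim x)
    then have pos: "0 < w (x (i e)) (x (j e))" if "e \<in> E" for e
      using t that by force
    then have "0 < F x" unfolding F_def by (intro prod_pos) auto
    moreover have "ln (F x) = (\<Sum>e\<in>E. ln (w (x (i e)) (x (j e))))"
      unfolding F_def by (intro ln_prod fin(2)) (rule less_imp_neq[OF pos, symmetric])
    moreover have "(\<Sum>e\<in>E. ?u e x) = (\<Sum>e\<in>E. ln (w (x (i e)) (x (j e))))"
      using elim by (intro sum.cong) (simp_all add: u_def max_absorb2)
    ultimately show ?case
      by linarith
  qed
  \<comment> \<open>The logarithm is strictly increasing, so both factors have the same sign.\<close>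
  have mono: "0 \<le> (r - t) * (ln r - ln t) \<and> ((r - t) * (ln r - ln t) = 0 \<longrightarrow> r = t)"
    if "0 < r" for r
    using t that by (cases "r \<le> t") (auto simp: zero_le_mult_iff)
  have "AE x in ?P. 0 \<le> D x"
    using log_F by eventually_elim (simp add: D_def mono)
  then have "AE x in ?P. D x = 0"
    using integral_nonneg_eq_0_iff_AE[OF int_D] D_mean by simp
  with log_F have "AE x in ?P. (\<Sum>e\<in>E. ?u e x) = ln t"
  proof eventually_elim
    case (elim x)
    then show ?case using mono[of "F x"] by (auto simp: D_def)
  qed
  then have "AE p in M \<Otimes>\<^sub>M M. u (fst p) (snd p) = ln t / card E"
    using meas_u
    by (intro constant_edge_sum_imp_constant[OF fin ends _ u_bound])
       (auto simp: split_beta' u_def sym)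
  with w_ge show ?thesis
  proof eventually_elim
    case (elim p)
    then have w_pos: "0 < w (fst p) (snd p)" and log: "ln (w (fst p) (snd p)) = ln t / card E"
      using t by (auto simp: u_def max_absorb2)
    from w_pos have "w (fst p) (snd p) = exp (ln (w (fst p) (snd p)))"
      by simp
    also have "\<dots> = t powr (1 / card E)"
      using t by (simp add: log powr_def)
    finally show ?case .
  qed
qed

end

section \<open>From Lebesgue measurable graphons to Borel kernels\<close>

lemma pair_measure_restrict_space:
  assumes "sigma_finite_measure M1" "sigma_finite_measure M2" "X \<in> sets M1" "Y \<in> sets M2"
  shows "restrict_space M1 X \<Otimes>\<^sub>M restrict_space M2 Y = restrict_space (M1 \<Otimes>\<^sub>M M2) (X \<times> Y)"
proof (rule pair_measure_eqI)
  interpret M2: sigma_finite_measure M2 by fact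
  show "sigma_finite_measure (restrict_space M1 X)" "sigma_finite_measure (restrict_space M2 Y)"
    using assms by (auto intro!: sigma_finite_measure_restrict_space)
  have sub: "X \<subseteq> space M1" "Y \<subseteq> space M2"
    using assms sets.sets_into_space by auto
  have "A \<times> B \<in> sets (restrict_space (M1 \<Otimes>\<^sub>M M2) (X \<times> Y))"
    if "A \<in> sets (restrict_space M1 X)" "B \<in> sets (restrict_space M2 Y)" for A B
    using that assms by (auto simp: sets_restrict_space_iff)
  moreover have "space (restrict_space M1 X) \<times> space (restrict_space M2 Y)
      = space (restrict_space (M1 \<Otimes>\<^sub>M M2) (X \<times> Y))"
    using sub by (auto simp: space_restrict_space space_pair_measure)
  ultimately have "sets (restrict_space M1 X \<Otimes>\<^sub>M restrict_space M2 Y)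
      \<subseteq> sets (restrict_space (M1 \<Otimes>\<^sub>M M2) (X \<times> Y))"
    unfolding sets_pair_measure by (auto intro!: sets.sigma_sets_subset)
  moreover have "A \<in> sets (restrict_space M1 X \<Otimes>\<^sub>M restrict_space M2 Y)"
    if A: "A \<in> sets (restrict_space (M1 \<Otimes>\<^sub>M M2) (X \<times> Y))" for A
  proof -
    have "(\<lambda>p. (fst p, snd p)) \<in> restrict_space M1 X \<Otimes>\<^sub>M restrict_space M2 Y \<rightarrow>\<^sub>M M1 \<Otimes>\<^sub>M M2"
      by (rule measurable_Pair[OF
            measurable_compose[OF measurable_fst measurable_restrict_space1[OF measurable_ident_sets[OF refl]]]
            measurable_compose[OF measurable_snd measurable_restrict_space1[OF measurable_ident_sets[OF refl]]]])
    then have "(\<lambda>p. p) \<in> restrict_space M1 X \<Otimes>\<^sub>M restrict_space M2 Y \<rightarrow>\<^sub>M M1 \<Otimes>\<^sub>M M2"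
      by simp
    moreover have "A \<in> sets (M1 \<Otimes>\<^sub>M M2)" "A \<subseteq> X \<times> Y"
      using A assms by (auto simp: sets_restrict_space_iff)
    ultimately have "(\<lambda>p. p) -` A \<inter> space (restrict_space M1 X \<Otimes>\<^sub>M restrict_space M2 Y)
        \<in> sets (restrict_space M1 X \<Otimes>\<^sub>M restrict_space M2 Y)"
      by (intro measurable_sets)
    also have "(\<lambda>p. p) -` A \<inter> space (restrict_space M1 X \<Otimes>\<^sub>M restrict_space M2 Y) = A"
      using \<open>A \<subseteq> X \<times> Y\<close> sub by (auto simp: space_restrict_space space_pair_measure)
    finally show ?thesis .
  qed
  ultimately show "sets (restrict_space M1 X \<Otimes>\<^sub>M restrict_space M2 Y)
      = sets (restrict_space (M1 \<Otimes>\<^sub>M M2) (X \<times> Y))"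
    by blast
  fix A B assume "A \<in> sets (restrict_space M1 X)" "B \<in> sets (restrict_space M2 Y)"
  then have "A \<in> sets M1" "A \<subseteq> X" "B \<in> sets M2" "B \<subseteq> Y"
    using assms by (auto simp: sets_restrict_space_iff)
  then show "emeasure (restrict_space M1 X) A * emeasure (restrict_space M2 Y) B
      = emeasure (restrict_space (M1 \<Otimes>\<^sub>M M2) (X \<times> Y)) (A \<times> B)"
    using assms sub
    by (subst (1 2 3) emeasure_restrict_space) (auto simp: M2.emeasure_pair_measure_Times)
qed

text \<open>
  Agreeing with the measurable function \<open>g\<close> outside a null set of \<open>M\<close> makes \<open>f\<close> measurable for
  the completion, even if it is not so for \<open>M\<close>; the Bochner integral of \<open>f\<close> is then meaningful.
\<close>

lemma integral_completion_AE_eq: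
  fixes f g :: "'a \<Rightarrow> real"
  assumes g: "g \<in> borel_measurable M" and eq: "AE x in M. f x = g x"
  shows "integral\<^sup>L (completion M) f = integral\<^sup>L M g"
proof -
  have g': "g \<in> borel_measurable (completion M)"
    using g by (rule measurable_completion)
  have eq': "AE x in completion M. f x = g x"
    using eq by (rule AE_completion)
  have f: "f \<in> borel_measurable (completion M)"
  proof (rule measurableI)
    fix A :: "real set" assume "A \<in> sets borel"
    with g' have A: "g -` A \<inter> space (completion M) \<in> sets (completion M)"
      by (rule measurable_sets)
    have "AE x in completion M. x \<in> g -` A \<inter> space (completion M)
        \<longleftrightarrow> x \<in> f -` A \<inter> space (completion M)"
      using eq' by eventually_elim simp
    then show "f -` A \<inter> space (completion M) \<in> sets (completion M)"
      by (rule completion.in_sets_AE[OF _ A]) (rule Int_lower2)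
  qed simp
  have "integral\<^sup>L (completion M) f = integral\<^sup>L (completion M) g"
    using f g' eq' by (rule integral_cong_AE)
  also have "\<dots> = integral\<^sup>L M g"
    using g by (rule integral_completion)
  finally show ?thesis .
qed

abbreviation unit_interval :: "real measure" where
  "unit_interval \<equiv> restrict_space lborel {0..1}"

lemma prob_space_unit_interval: "prob_space unit_interval"
  by (rule prob_spaceI) (simp add: emeasure_restrict_space space_restrict_space)

lemma AE_unit_square_iff:
  "(AE p in unit_square. P p) \<longleftrightarrow> (AE p in unit_interval \<Otimes>\<^sub>M unit_interval. P p)"
proof -
  have sq: "{0..1::real} \<times> {0..1::real} \<in> sets borel"
    by (intro borel_closed closed_Times) auto
  have "unit_interval \<Otimes>\<^sub>M unit_interval = restrict_space lborel ({0..1} \<times> {0..1})"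
    by (subst pair_measure_restrict_space) (auto simp: lborel.sigma_finite_measure_axioms lborel_prod)
  then have "(AE p in unit_interval \<Otimes>\<^sub>M unit_interval. P p) \<longleftrightarrow>
      (AE p in restrict_space lborel ({0..1} \<times> {0..1}). P p)"
    by (simp only:)
  with sq show ?thesis
    by (simp add: AE_restrict_space_iff AE_completion_iff)
qed

text \<open>
  A Borel version of \<open>W\<close> is symmetric and takes values in the unit interval only almost
  everywhere. Averaging it with its transpose and clipping the result gives both
  everywhere, and changes nothing where the version and its transpose agree with \<open>W\<close>.
\<close>

lemma graphon_borel_version:
  assumes "graphon W"
  obtains W' where "(\<lambda>(x, y). W' x y) \<in> borel_measurable (unit_interval \<Otimes>\<^sub>M unit_interval)"
    and "\<And>x y. W' x y = W' y x" and "\<And>x y. 0 \<le> W' x y \<and> W' x y \<le> 1"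
    and "AE p in unit_interval \<Otimes>\<^sub>M unit_interval. W (fst p) (snd p) = W' (fst p) (snd p)"
proof -
  let ?U = "unit_interval" and ?S = "{0..1::real} \<times> {0..1::real}"
  interpret U: prob_space ?U by (rule prob_space_unit_interval)
  interpret UU: pair_sigma_finite ?U ?U by unfold_locales
  have sq: "?S \<in> sets borel"
    by (intro borel_closed closed_Times) auto
  have "(\<lambda>(x, y). W x y) \<in> borel_measurable (lebesgue_on ?S)"
    using assms by (simp add: graphon_def)
  then have "(\<lambda>p. if p \<in> ?S then case p of (x, y) \<Rightarrow> W x y else 0) \<in> borel_measurable lebesgue"
    using sq by (subst (asm) measurable_restrict_space_iff[of _ _ 0]) auto
  then obtain B where B: "B \<in> borel_measurable lborel"
    and "AE p in lborel. (if p \<in> ?S then case p of (x, y) \<Rightarrow> W x y else 0) = B p"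
    using completion_ex_borel_measurable_real by blast
  then have "AE p in lborel. p \<in> ?S \<longrightarrow> W (fst p) (snd p) = B p"
    by (elim eventually_mono) (auto split: if_splits)
  then have "AE p in unit_square. W (fst p) (snd p) = B p"
    using sq by (simp add: AE_restrict_space_iff AE_completion_iff)
  then have eq: "AE p in ?U \<Otimes>\<^sub>M ?U. W (fst p) (snd p) = B p"
    by (simp add: AE_unit_square_iff)
  then have "AE p in distr (?U \<Otimes>\<^sub>M ?U) (?U \<Otimes>\<^sub>M ?U) (\<lambda>(x, y). (y, x)). W (fst p) (snd p) = B p"
    by (subst UU.distr_pair_swap[symmetric])
  from AE_distrD[OF measurable_pair_swap' this]
  have eq': "AE p in ?U \<Otimes>\<^sub>M ?U. W (snd p) (fst p) = B (snd p, fst p)"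
    by (simp add: split_beta')
  define W' where "W' x y = max 0 (min 1 ((B (x, y) + B (y, x)) / 2))" for x y
  have [measurable]: "B \<in> borel_measurable (borel \<Otimes>\<^sub>M borel)"
    using B by (simp add: borel_prod)
  have "(\<lambda>(x, y). W' x y) \<in> borel_measurable (borel \<Otimes>\<^sub>M borel)"
    unfolding W'_def by measurable
  moreover have "(\<lambda>p. (fst p, snd p)) \<in> ?U \<Otimes>\<^sub>M ?U \<rightarrow>\<^sub>M borel \<Otimes>\<^sub>M borel"
    by (intro measurable_Pair measurable_compose[OF measurable_fst] measurable_compose[OF measurable_snd]
        measurable_restrict_space1) auto
  ultimately have "(\<lambda>p. case (fst p, snd p) of (x, y) \<Rightarrow> W' x y) \<in> borel_measurable (?U \<Otimes>\<^sub>M ?U)"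
    by (rule measurable_compose[rotated])
  then have "(\<lambda>(x, y). W' x y) \<in> borel_measurable (?U \<Otimes>\<^sub>M ?U)"
    by (simp add: split_beta')
  moreover have "W' x y = W' y x" "0 \<le> W' x y \<and> W' x y \<le> 1" for x y
    by (auto simp: W'_def add.commute)
  moreover have "AE p in ?U \<Otimes>\<^sub>M ?U. W (fst p) (snd p) = W' (fst p) (snd p)"
    using eq eq' AE_space
  proof eventually_elim
    case (elim p)
    then have "fst p \<in> {0..1}" "snd p \<in> {0..1}"
      by (auto simp: space_pair_measure space_restrict_space)
    then have "W (fst p) (snd p) = W (snd p) (fst p)" "0 \<le> W (fst p) (snd p)" "W (fst p) (snd p) \<le> 1"
      using assms unfolding graphon_def by blast+
    then show ?case
      using elim(1,2)[symmetric] by (simp add: W'_def)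
  qed
  ultimately show ?thesis
    by (rule that)
qed

section \<open>Graphons with constant rooted densities\<close>

theorem theorem1p1:
  fixes V :: "'v set" and E :: "'v set set" and W :: "real \<Rightarrow> real \<Rightarrow> real"
  assumes "simple_graph V E"
    and "card E \<ge> 1"
    and "graphon W"
    and "\<And>a b. {a, b} \<in> E \<Longrightarrow>
           \<exists>c. AE (x, y) in unit_square. rooted_density V E a b W x y = c"
  shows "hom_density V E W = 0 \<or>
         (AE (x, y) in unit_square. W x y = hom_density V E W powr (1 / card E))"
proof -
  let ?U = unit_interval
  let ?P = "\<lambda>I. PiM I (\<lambda>_::'v. ?U)"
  interpret U: prob_space ?U by (rule prob_space_unit_interval)
  interpret UU: pair_prob_space ?U ?U by unfold_locales
  have fin: "finite V" "finite E" "E \<noteq> {}"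
    using assms(1,2) by (simp add: simple_graph_def, intro card_ge_0_finite, simp, force)
  have "\<exists>p. fst p \<in> V \<and> snd p \<in> V \<and> fst p \<noteq> snd p \<and> e = {fst p, snd p}" if "e \<in> E" for e
  proof -
    have e: "e \<subseteq> V" "card e = 2"
      using assms(1) that by (simp_all add: simple_graph_def)
    then obtain a b where "e = {a, b}" "a \<noteq> b"
      by (meson card_2_iff)
    with e(1) show ?thesis
      by (intro exI[of _ "(a, b)"]) simp
  qed
  then have "\<forall>e\<in>E. \<exists>p. fst p \<in> V \<and> snd p \<in> V \<and> fst p \<noteq> snd p \<and> e = {fst p, snd p}"
    by blast
  from bchoice[OF this] obtain ij where ij:
    "\<forall>e\<in>E. fst (ij e) \<in> V \<and> snd (ij e) \<in> V \<and> fst (ij e) \<noteq> snd (ij e) \<and> e = {fst (ij e), snd (ij e)}"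
    by (rule exE)
  define i j where "i = fst \<circ> ij" and "j = snd \<circ> ij"
  have ends: "i e \<in> V \<and> j e \<in> V \<and> i e \<noteq> j e \<and> e = {i e, j e}" if "e \<in> E" for e
    unfolding i_def j_def comp_def using ij that by (rule bspec)
  obtain W' where W'_meas: "(\<lambda>(x, y). W' x y) \<in> borel_measurable (?U \<Otimes>\<^sub>M ?U)"
    and W'_sym: "\<And>x y. W' x y = W' y x" and W'_bound: "\<And>x y. 0 \<le> W' x y \<and> W' x y \<le> 1"
    and W'_eq: "AE p in ?U \<Otimes>\<^sub>M ?U. W (fst p) (snd p) = W' (fst p) (snd p)"
    using graphon_borel_version[OF assms(3)] by blast
  define F where "F x = (\<Prod>e\<in>E. W' (x (i e)) (x (j e)))" for x
  define t where "t = (\<integral>x. F x \<partial>?P V)"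
  have coord: "(\<lambda>x. x l) \<in> ?P V \<rightarrow>\<^sub>M ?U" if "l \<in> V" for l
    using that by (rule measurable_component_singleton)
  have F_meas: "F \<in> borel_measurable (?P V)"
    unfolding F_def
  proof (rule borel_measurable_prod)
    fix e assume "e \<in> E"
    then show "(\<lambda>x. W' (x (i e)) (x (j e))) \<in> borel_measurable (?P V)"
      using measurable_compose[OF measurable_Pair[OF coord coord] W'_meas, of "i e" "j e"] ends by simp
  qed
  have F_bound: "0 \<le> F x" "\<bar>F x\<bar> \<le> 1" for x
  proof -
    show "0 \<le> F x" unfolding F_def using W'_bound by (intro prod_nonneg) auto
    moreover have "F x \<le> 1" unfolding F_def using W'_bound by (intro prod_le_1) auto
    ultimately show "\<bar>F x\<bar> \<le> 1" by simp
  qed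
  have agree: "AE x in ?P V. (\<Prod>e\<in>E. edge_factor W x e) = F x"
  proof -
    have "AE x in ?P V. \<forall>e\<in>E. W (x (i e)) (x (j e)) = W' (x (i e)) (x (j e))"
      using U.AE_two_coordinates[OF fin(1) _ _ _ W'_eq] ends fin(2) by (intro AE_finite_allI) auto
    then show ?thesis
      using AE_space
    proof eventually_elim
      case (elim x)
      have "edge_factor W x e = W' (x (i e)) (x (j e))" if e: "e \<in> E" for e
      proof -
        have "x l \<in> {0..1}" if "l \<in> V" for l
          using measurable_space[OF coord[OF that] elim(2)] by (simp add: space_restrict_space)
        then have "x (i e) \<in> {0..1}" "x (j e) \<in> {0..1}"
          using ends[OF e] by blast+
        from edge_factor_insert[of W x "i e" "j e", OF assms(3) this]
        have "edge_factor W x {i e, j e} = W' (x (i e)) (x (j e))"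
          using elim(1) e by simp
        then show ?thesis
          using ends[OF e] by metis
      qed
      then show ?case by (simp add: F_def)
    qed
  qed
  have hom: "hom_density V E W = t"
    unfolding hom_density_def unit_cube_def t_def
    by (rule integral_completion_AE_eq[OF F_meas agree])
  show ?thesis
  proof (cases "t = 0")
    case False
    then have "0 < t"
      using F_bound by (simp add: t_def less_le)
    \<comment> \<open>The unspecified constants are all equal to \<open>t\<close>, as seen by integrating over the roots.\<close>
    have "AE p in ?U \<Otimes>\<^sub>M ?U. (\<integral>z. F (z(i e := fst p, j e := snd p)) \<partial>?P (V - {i e, j e})) = t"
      if e: "e \<in> E" for e
    proof -
      let ?J = "?P (V - {i e, j e})"
      let ?r = "\<lambda>p. \<integral>z. F (z(i e := fst p, j e := snd p)) \<partial>?J"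
      interpret J: prob_space ?J by (rule U.prob_space_power)
      have ij: "i e \<in> V" "j e \<in> V" "i e \<noteq> j e"
        using ends[OF e] by blast+
      have ij_edge: "{i e, j e} \<in> E"
        using ends[OF e] e by metis
      have meas: "(\<lambda>(p, z). F (z(i e := fst p, j e := snd p))) \<in> borel_measurable ((?U \<Otimes>\<^sub>M ?U) \<Otimes>\<^sub>M ?J)"
        using measurable_compose[OF measurable_insert_two_coordinates[OF ij(1,2)] F_meas]
        by (simp add: split_beta')
      obtain c where "AE (x, y) in unit_square. rooted_density V E (i e) (j e) W x y = c"
        using assms(4)[OF ij_edge] by blast
      then have "AE p in ?U \<Otimes>\<^sub>M ?U. rooted_density V E (i e) (j e) W (fst p) (snd p) = c"
        by (simp add: AE_unit_square_iff split_beta')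
      with U.AE_insert_two_coordinates[OF fin(1) ij(1-3) agree] AE_space
      have c: "AE p in ?U \<Otimes>\<^sub>M ?U. ?r p = c"
      proof eventually_elim
        case (elim p)
        have "rooted_density V E (i e) (j e) W (fst p) (snd p) = ?r p"
          unfolding rooted_density_def unit_cube_def
          using measurable_Pair2[OF meas elim(2)] elim(1) by (intro integral_completion_AE_eq) auto
        with elim(3) show ?case by simp
      qed
      have "t = (\<integral>p. ?r p \<partial>(?U \<Otimes>\<^sub>M ?U))"
        unfolding t_def
        by (rule U.integral_insert_two_coordinates[OF fin(1) ij(1-3) F_meas F_bound(2)])
      also have "\<dots> = (\<integral>p. c \<partial>(?U \<Otimes>\<^sub>M ?U))"
        using J.borel_measurable_lebesgue_integral[OF meas] c by (intro integral_cong_AE) auto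
      also have "\<dots> = c"
        by (simp add: UU.prob_space)
      finally show ?thesis using c by simp
    qed
    then have "AE p in ?U \<Otimes>\<^sub>M ?U. W' (fst p) (snd p) = t powr (1 / card E)"
      unfolding F_def
      by (intro U.constant_rooted_densities_imp_constant[OF fin ends W'_meas W'_bound W'_sym \<open>0 < t\<close>])
    with W'_eq have "AE p in ?U \<Otimes>\<^sub>M ?U. W (fst p) (snd p) = t powr (1 / card E)"
      by eventually_elim simp
    then show ?thesis
      by (simp add: hom AE_unit_square_iff split_beta')
  qed (simp add: hom)
qed

end
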